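(* For positive integers $k\ge \ell\ge 2$, the limit \[c_{k,\ell}=\lim_{n\to\infty}\frac{c_{n,k,\ell}}{n^{k-2}}\] exists.
   Context: Let $H_{n,k}=\{0,1,\dots,n-1\}^k$. For $\ell\le k$, an $\ell$-rook is a point $P\in H_{n,k}$ together with a set $D$ of $\ell$ of the $k$ coordinate indices; it covers (attacks) $P$ itself and every point of $H_{n,k}$ which differs from $P$ in exactly one coordinate, that coordinate belonging to $D$. Distinct rooks must occupy distinct points. $c_{n,k,\ell}$ is the maximum number of $\ell$-rooks that can be placed in $H_{n,k}$ so that no point of $H_{n,k}$ is covered by two different rooks. *)

theory Defs
  imports Complex_Main "HOL-Library.FuncSet"
begin

text \<open>Points are extensional functions, so that equality of points is equality of all
  coordinates with index below \<open>k\<close>.\<close>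

definition hypercube :: "nat \<Rightarrow> nat \<Rightarrow> (nat \<Rightarrow> nat) set" where
  "hypercube n k = {..<k} \<rightarrow>\<^sub>E {..<n}"

type_synonym rook = "(nat \<Rightarrow> nat) \<times> nat set"

definition rooks :: "nat \<Rightarrow> nat \<Rightarrow> nat \<Rightarrow> rook set" where
  "rooks n k l = {(P, D). P \<in> hypercube n k \<and> D \<subseteq> {..<k} \<and> card D = l}"

fun covered :: "nat \<Rightarrow> nat \<Rightarrow> rook \<Rightarrow> (nat \<Rightarrow> nat) set" where
  "covered n k (P, D) =
     {Q \<in> hypercube n k. Q = P \<or> (\<exists>i\<in>D. {j. j < k \<and> Q j \<noteq> P j} = {i})}"

definition rook_packing :: "nat \<Rightarrow> nat \<Rightarrow> nat \<Rightarrow> rook set \<Rightarrow> bool" where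
  "rook_packing n k l R \<longleftrightarrow>
     R \<subseteq> rooks n k l \<and> inj_on fst R \<and>
     (\<forall>r\<in>R. \<forall>s\<in>R. r \<noteq> s \<longrightarrow> covered n k r \<inter> covered n k s = {})"

text \<open>The maximum is over a finite nonempty set: \<open>rooks n k l\<close> is finite and
  the empty set is a packing.\<close>

definition max_rooks :: "nat \<Rightarrow> nat \<Rightarrow> nat \<Rightarrow> nat" where
  "max_rooks n k l = Max {card R |R. rook_packing n k l R}"

end

theory Submission
  imports Defs
begin

text \<open>Write \<open>f n = c\<^sub>n / n ^ (k - 2)\<close>. Two rooks lying in a common \<open>(i, j)\<close>-plane cannot both attack
  along \<open>i\<close> and \<open>j\<close>, so \<open>f\<close> is bounded. If \<open>m\<close> is coprime to all of \<open>1, \<dots>, k - 1\<close>, there is a code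
  \<open>S\<close> in the cube of side \<open>m\<close> with at least \<open>m ^ (k - 2)\<close> words and minimum distance 3; replacing
  each rook of a packing in the cube of side \<open>n\<close> by a copy of \<open>S\<close> gives \<open>f n \<le> f (n * m)\<close>. Such \<open>m\<close>
  include all numbers congruent to 1 modulo \<open>k!\<close>, which have bounded gaps, and \<open>c\<^sub>n\<close> is
  nondecreasing in \<open>n\<close>; hence \<open>liminf f \<ge> f n\<close> for every \<open>n\<close>, and \<open>f\<close> converges to its supremum.\<close>

section \<open>The cube and the set of rooks\<close>

lemma finite_hypercube: "finite (hypercube n k)"
  unfolding hypercube_def by (intro finite_PiE) auto

lemma card_hypercube: "card (hypercube n k) = n ^ k"
  unfolding hypercube_def by (simp add: card_PiE)

lemma hypercube_less: "P \<in> hypercube n k \<Longrightarrow> t < k \<Longrightarrow> P t < n"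
  unfolding hypercube_def by auto

lemma hypercube_eqI:
  assumes "P \<in> hypercube n k" "Q \<in> hypercube n k" "\<And>t. t < k \<Longrightarrow> P t = Q t"
  shows "P = Q"
  using assms(1,2) unfolding hypercube_def by (rule PiE_ext) (simp add: assms(3))

lemma restrict_in_hypercube:
  "(\<And>t. t < k \<Longrightarrow> g t < n) \<Longrightarrow> (\<lambda>t\<in>{..<k}. g t) \<in> hypercube n k"
  unfolding hypercube_def by auto

lemma hypercube_mono: "n \<le> N \<Longrightarrow> hypercube n k \<subseteq> hypercube N k"
  unfolding hypercube_def by (intro PiE_mono) auto

lemma finite_rooks: "finite (rooks n k l)"
proof (rule finite_subset)
  show "rooks n k l \<subseteq> hypercube n k \<times> Pow {..<k}"
    unfolding rooks_def by auto
qed (simp add: finite_hypercube)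

section \<open>Coverage and packings in terms of agreement of coordinates\<close>

text \<open>Equality inside \<open>I\<close> is allowed, so \<open>agree_off k {i}\<close> describes
  a whole line, the rook's own point included. Agreement of \<open>Q\<close> with \<open>P\<close>
  off \<open>I\<close> and with \<open>P'\<close> off \<open>J\<close> gives agreement of
  \<open>P\<close> with \<open>P'\<close> off the union.\<close>

definition agree_off :: "nat \<Rightarrow> nat set \<Rightarrow> (nat \<Rightarrow> nat) \<Rightarrow> (nat \<Rightarrow> nat) \<Rightarrow> bool" where
  "agree_off k I P Q \<longleftrightarrow> (\<forall>t<k. t \<notin> I \<longrightarrow> P t = Q t)"

text \<open>The separate case \<open>Q = P\<close> of \<open>covered\<close> is absorbed:
  \<open>D\<close> is nonempty because \<open>l \<ge> 1\<close>, and the rook's point lies on each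
  of its own lines.\<close>

lemma mem_covered_iff:
  assumes "(P, D) \<in> rooks n k l" "l \<ge> 1"
  shows "Q \<in> covered n k (P, D) \<longleftrightarrow> Q \<in> hypercube n k \<and> (\<exists>i\<in>D. agree_off k {i} Q P)"
proof
  assume Q: "Q \<in> covered n k (P, D)"
  have "D \<noteq> {}" using assms by (auto simp: rooks_def)
  with Q show "Q \<in> hypercube n k \<and> (\<exists>i\<in>D. agree_off k {i} Q P)"
    by (auto simp: agree_off_def)
next
  assume *: "Q \<in> hypercube n k \<and> (\<exists>i\<in>D. agree_off k {i} Q P)"
  then obtain i where i: "i \<in> D" "agree_off k {i} Q P" by auto
  have ik: "i < k" and P: "P \<in> hypercube n k" using assms i by (auto simp: rooks_def)
  show "Q \<in> covered n k (P, D)"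
  proof (cases "Q i = P i")
    case True
    then have "Q = P"
      using * i P by (intro hypercube_eqI[of Q n k P]) (auto simp: agree_off_def)
    then show ?thesis using * by simp
  next
    case False
    then have "{j. j < k \<and> Q j \<noteq> P j} = {i}"
      using i ik by (auto simp: agree_off_def)
    then show ?thesis using * i by auto
  qed
qed

text \<open>Injectivity of \<open>fst\<close> needs no clause of its own: two rooks on the same
  point both attack that point, so the condition on common attacked points already identifies
  them.\<close>

lemma rook_packing_iff:
  assumes "l \<ge> 1"
  shows "rook_packing n k l R \<longleftrightarrow> R \<subseteq> rooks n k l \<and>
    (\<forall>P D P' D' Q i i'. (P, D) \<in> R \<longrightarrow> (P', D') \<in> R \<longrightarrow> Q \<in> hypercube n k \<longrightarrow> i \<in> D \<longrightarrow> i' \<in> D' \<longrightarrow>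
       agree_off k {i} Q P \<longrightarrow> agree_off k {i'} Q P' \<longrightarrow> (P, D) = (P', D'))"
    (is "_ \<longleftrightarrow> ?S \<and> ?C")
proof (cases ?S)
  case sub: True
  have disj: "?C \<longleftrightarrow> (\<forall>r\<in>R. \<forall>s\<in>R. r \<noteq> s \<longrightarrow> covered n k r \<inter> covered n k s = {})" (is "_ \<longleftrightarrow> ?C'")
  proof
    assume c: ?C
    show ?C'
    proof (intro ballI impI, rule ccontr)
      fix r s assume rs: "r \<in> R" "s \<in> R" "r \<noteq> s" "covered n k r \<inter> covered n k s \<noteq> {}"
      obtain P D P' D' where eq: "r = (P, D)" "s = (P', D')" by (metis surj_pair)
      from rs obtain Q where "Q \<in> covered n k (P, D)" "Q \<in> covered n k (P', D')"
        unfolding eq by blast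
      moreover have "(P, D) \<in> rooks n k l" "(P', D') \<in> rooks n k l" using rs sub eq by auto
      ultimately obtain i i' where "Q \<in> hypercube n k" "i \<in> D" "i' \<in> D'"
          "agree_off k {i} Q P" "agree_off k {i'} Q P'"
        unfolding mem_covered_iff[OF \<open>(P, D) \<in> rooks n k l\<close> assms]
          mem_covered_iff[OF \<open>(P', D') \<in> rooks n k l\<close> assms] by blast
      then show False using c rs eq by blast
    qed
  next
    assume c: ?C'
    show ?C
    proof (intro allI impI, rule ccontr)
      fix P D P' D' Q i i'
      assume r: "(P, D) \<in> R" "(P', D') \<in> R"
        and q: "Q \<in> hypercube n k" "i \<in> D" "i' \<in> D'"
          "agree_off k {i} Q P" "agree_off k {i'} Q P'" and ne: "(P, D) \<noteq> (P', D')"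
      have "Q \<in> covered n k (P, D)" "Q \<in> covered n k (P', D')"
        using r q sub mem_covered_iff[OF _ assms] by blast+
      with c r ne show False by blast
    qed
  qed
  have "inj_on fst R" if ?C
  proof (rule inj_onI)
    fix r s assume rs: "r \<in> R" "s \<in> R" "fst r = fst s"
    obtain P D D' where eq: "r = (P, D)" "s = (P, D')" using rs by (metis prod.collapse)
    have "P \<in> hypercube n k" "D \<noteq> {}" "D' \<noteq> {}"
      using rs sub assms by (auto simp: eq rooks_def)
    then obtain i i' where "i \<in> D" "i' \<in> D'" by auto
    moreover have "agree_off k {i} P P" "agree_off k {i'} P P" by (auto simp: agree_off_def)
    ultimately show "r = s" using that rs \<open>P \<in> hypercube n k\<close> unfolding eq by blast
  qed
  then show ?thesis using sub disj unfolding rook_packing_def by blast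
qed (auto simp: rook_packing_def)

lemma rook_packingD:
  assumes "rook_packing n k l R" "l \<ge> 1" "(P, D) \<in> R" "(P', D') \<in> R" "Q \<in> hypercube n k"
    "i \<in> D" "i' \<in> D'" "agree_off k {i} Q P" "agree_off k {i'} Q P'"
  shows "(P, D) = (P', D')"
  using assms unfolding rook_packing_iff[OF \<open>l \<ge> 1\<close>] by blast

lemma rook_packing_subset: "rook_packing n k l R \<Longrightarrow> R \<subseteq> rooks n k l"
  by (simp add: rook_packing_def)

lemma rook_packing_in_hypercube: "rook_packing n k l R \<Longrightarrow> (P, D) \<in> R \<Longrightarrow> P \<in> hypercube n k"
  by (auto simp: rook_packing_def rooks_def)

section \<open>The maximum and its monotonicity in the side length\<close>

lemma finite_rook_packing_cards: "finite {card R |R. rook_packing n k l R}"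
  by (rule finite_subset[of _ "card ` Pow (rooks n k l)"])
    (auto simp: finite_rooks dest: rook_packing_subset)

lemma card_le_max_rooks: "rook_packing n k l R \<Longrightarrow> card R \<le> max_rooks n k l"
  unfolding max_rooks_def by (rule Max_ge[OF finite_rook_packing_cards]) blast

lemma max_rooks_attained:
  obtains R where "rook_packing n k l R" "card R = max_rooks n k l"
proof -
  have "rook_packing n k l {}" by (simp add: rook_packing_def)
  then have "{card R |R. rook_packing n k l R} \<noteq> {}" by blast
  from Max_in[OF finite_rook_packing_cards this] that show ?thesis
    unfolding max_rooks_def by force
qed

text \<open>A larger cube lengthens the attacked lines, yet creates no new conflict. If two rooks
  attack \<open>Q\<close> along different directions, every coordinate of \<open>Q\<close> comes
  from one of the two rooks, so \<open>Q\<close> was in the small cube. If the directions coincide,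
  the rooks share a line and the point \<open>P\<close> is attacked by both.\<close>

lemma rook_packing_mono:
  assumes R: "rook_packing n k l R" and "n \<le> N" and l: "l \<ge> 1"
  shows "rook_packing N k l R"
  unfolding rook_packing_iff[OF l]
proof (intro conjI allI impI)
  show "R \<subseteq> rooks N k l"
    using rook_packing_subset[OF R] hypercube_mono[OF \<open>n \<le> N\<close>] by (force simp: rooks_def)
next
  fix P D P' D' Q i i'
  assume r: "(P, D) \<in> R" "(P', D') \<in> R" and Q: "Q \<in> hypercube N k"
    and i: "i \<in> D" "i' \<in> D'" and a: "agree_off k {i} Q P" "agree_off k {i'} Q P'"
  have P: "P \<in> hypercube n k" "P' \<in> hypercube n k"
    using r rook_packing_in_hypercube[OF R] by blast+
  show "(P, D) = (P', D')"
  proof (cases "i = i'")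
    case True
    with a have "agree_off k {i} P P" "agree_off k {i'} P P'" by (auto simp: agree_off_def)
    then show ?thesis using rook_packingD[OF R l r P(1) i] by blast
  next
    case False
    have "Q t < n" if "t < k" for t
      using that False a hypercube_less[OF P(1) that] hypercube_less[OF P(2) that]
      by (cases "t = i") (auto simp: agree_off_def)
    then have "Q \<in> hypercube n k" using Q by (auto simp: hypercube_def PiE_iff)
    then show ?thesis using rook_packingD[OF R l r _ i a] by blast
  qed
qed

lemma max_rooks_mono:
  assumes "n \<le> N" "l \<ge> 1"
  shows "max_rooks n k l \<le> max_rooks N k l"
  by (metis assms card_le_max_rooks max_rooks_attained rook_packing_mono)

section \<open>The upper bound of order \<open>n ^ (k - 2)\<close>\<close>

lemma rook_two_directions:
  assumes "(P, D) \<in> rooks n k l" "2 \<le> l"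
  shows "\<exists>i j. i \<in> D \<and> j \<in> D \<and> i \<noteq> j \<and> i < k \<and> j < k"
proof -
  have "D \<subseteq> {..<k}" "card D \<ge> 2" using assms by (simp_all add: rooks_def)
  then have "finite D" "\<not> card D \<le> Suc 0" using finite_subset by (blast, simp)
  then show ?thesis using \<open>D \<subseteq> {..<k}\<close> by (subst (asm) card_le_Suc0_iff_eq) blast+
qed

lemma rook_packing_plane_unique:
  assumes R: "rook_packing n k l R" "l \<ge> 1" and r: "(P, D) \<in> R" "(P', D') \<in> R"
    and ij: "i \<in> D'" "j \<in> D" "i \<noteq> j" and agree: "agree_off k {i, j} P P'"
  shows "(P, D) = (P', D')"
proof -
  \<comment> \<open>The corner where the line through \<open>P\<close> in direction \<open>j\<close>
    meets the line through \<open>P'\<close> in direction \<open>i\<close>.\<close>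
  define Q where "Q = P(j := P' j)"
  have PP: "P \<in> hypercube n k" "P' \<in> hypercube n k" and "j < k"
    using r ij rook_packing_subset[OF R(1)] by (auto simp: rooks_def)
  then have Q: "Q \<in> hypercube n k"
    by (auto simp: Q_def hypercube_def PiE_iff extensional_def)
  have "agree_off k {j} Q P" "agree_off k {i} Q P'"
    using agree by (auto simp: Q_def agree_off_def)
  then show ?thesis by (rule rook_packingD[OF R r Q ij(2,1)])
qed

lemma agree_off_iff_restrict_eq:
  "agree_off k I P Q \<longleftrightarrow> restrict P ({..<k} - I) = restrict Q ({..<k} - I)"
  unfolding agree_off_def restrict_def fun_eq_iff by auto

text \<open>Forgetting the coordinates \<open>i\<close> and \<open>j\<close> is injective on these
  rooks, since two of them with the same image lie in a common plane. Only \<open>k - 2\<close>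
  coordinates remain.\<close>

lemma card_packing_along_le:
  assumes R: "rook_packing n k l R" "l \<ge> 1" and ij: "i \<noteq> j" "i < k" "j < k"
  shows "card {r \<in> R. i \<in> snd r \<and> j \<in> snd r} \<le> n ^ (k - 2)"
proof -
  let ?A = "{r \<in> R. i \<in> snd r \<and> j \<in> snd r}" and ?J = "{..<k} - {i, j}"
  have "r = s" if "r \<in> ?A" "s \<in> ?A" "restrict (fst r) ?J = restrict (fst s) ?J" for r s
    using that ij rook_packing_plane_unique[OF R, of "fst r" "snd r" "fst s" "snd s" i j]
    by (simp add: agree_off_iff_restrict_eq prod_eq_iff)
  then have "inj_on (\<lambda>r. restrict (fst r) ?J) ?A" by (rule inj_onI)
  moreover have "restrict (fst r) ?J \<in> ?J \<rightarrow>\<^sub>E {..<n}" if "r \<in> R" for r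
    using that hypercube_less[OF rook_packing_in_hypercube[OF R(1), of "fst r" "snd r"]]
    by (simp add: restrict_PiE_iff)
  then have "(\<lambda>r. restrict (fst r) ?J) ` ?A \<subseteq> ?J \<rightarrow>\<^sub>E {..<n}" by blast
  moreover have "finite (?J \<rightarrow>\<^sub>E {..<n})" by (intro finite_PiE) simp_all
  ultimately have "card ?A \<le> card (?J \<rightarrow>\<^sub>E {..<n})" by (rule card_inj_on_le)
  moreover have "card ?J = k - 2" using ij by (subst card_Diff_subset) simp_all
  ultimately show ?thesis by (simp add: card_PiE)
qed

text \<open>Every rook attacks along some ordered pair of distinct directions, so at most
  \<open>k * k\<close> classes, each bounded by the previous lemma, exhaust the packing.\<close>

lemma max_rooks_le:
  assumes "2 \<le> l"
  shows "max_rooks n k l \<le> k * k * n ^ (k - 2)"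
proof -
  obtain R where R: "rook_packing n k l R" and card: "card R = max_rooks n k l"
    by (rule max_rooks_attained)
  let ?I = "{p \<in> {..<k} \<times> {..<k}. fst p \<noteq> snd p}"
  let ?A = "\<lambda>p. {r \<in> R. fst p \<in> snd r \<and> snd p \<in> snd r}"
  have "R \<subseteq> (\<Union>p\<in>?I. ?A p)"
    using rook_packing_subset[OF R] rook_two_directions[OF _ assms, of _ _ n k] by fastforce
  then have "R = (\<Union>p\<in>?I. ?A p)" by blast
  then have "card R \<le> (\<Sum>p\<in>?I. card (?A p))"
    using card_UN_le[of ?I ?A] by simp
  also have "\<dots> \<le> card ?I * n ^ (k - 2)"
    using assms by (intro sum_bounded_above[where 'a = nat, simplified] card_packing_along_le[OF R]) auto
  also have "\<dots> \<le> card ({..<k} \<times> {..<k}) * n ^ (k - 2)"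
    by (intro mult_right_mono card_mono) auto
  finally show ?thesis using card by simp
qed

section \<open>Codes of minimum distance 3\<close>

text \<open>Distance at least 3 in the form used for packings: two words that agree outside two
  coordinates are equal.\<close>

definition code3 :: "nat \<Rightarrow> nat \<Rightarrow> (nat \<Rightarrow> nat) set \<Rightarrow> bool" where
  "code3 m k S \<longleftrightarrow> S \<subseteq> hypercube m k \<and>
     (\<forall>b\<in>S. \<forall>c\<in>S. \<forall>i<k. \<forall>j<k. agree_off k {i, j} b c \<longrightarrow> b = c)"

lemma fibre_pigeonhole:
  assumes "finite A" "finite B" "g ` A \<subseteq> B" "card A = card B * q" "B \<noteq> {}"
  shows "\<exists>y\<in>B. q \<le> card {x \<in> A. g x = y}"
proof (rule ccontr)
  assume "\<not> ?thesis"
  then have "(\<Sum>y\<in>B. card {x \<in> A. g x = y}) < (\<Sum>y\<in>B. q)"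
    using assms by (intro sum_strict_mono) auto
  moreover have "(\<Sum>y\<in>B. card {x \<in> A. g x = y}) = card A"
    using sum.group[OF assms(1-3), of "\<lambda>_. 1::nat"] by simp
  ultimately show False using assms by simp
qed

text \<open>The two sums are parity checks modulo \<open>m\<close> with columns
  \<open>(1, t)\<close>. Columns \<open>i\<close> and \<open>j\<close> have determinant
  \<open>j - i\<close>, which is invertible modulo \<open>m\<close> by \<open>cop\<close>, so no
  nonzero difference supported on \<open>{i, j}\<close> passes both checks.\<close>

lemma weighted_sums_determine:
  fixes b c :: "nat \<Rightarrow> nat"
  assumes b: "b \<in> hypercube m k" and c: "c \<in> hypercube m k"
    and cop: "\<And>d. 0 < d \<Longrightarrow> d < k \<Longrightarrow> coprime m d"
    and s0: "(\<Sum>t<k. b t) mod m = (\<Sum>t<k. c t) mod m"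
    and s1: "(\<Sum>t<k. t * b t) mod m = (\<Sum>t<k. t * c t) mod m"
    and ij: "i < j" "j < k" and off: "agree_off k {i, j} b c"
  shows "b = c"
proof -
  define d where "d t = int (b t) - int (c t)" for t
  have zero: "d t = 0" if "t < k" "t \<noteq> i" "t \<noteq> j" for t
    using off that by (auto simp: d_def agree_off_def)
  have supp: "(\<Sum>t<k. w t * d t) = w i * d i + w j * d j" for w :: "nat \<Rightarrow> int"
  proof -
    have "(\<Sum>t<k. w t * d t) = (\<Sum>t\<in>{i, j}. w t * d t)"
      using ij zero by (intro sum.mono_neutral_right) auto
    then show ?thesis using ij by simp
  qed
  have dvd: "int m dvd (\<Sum>t<k. int (w t) * d t)"
    if "(\<Sum>t<k. w t * b t) mod m = (\<Sum>t<k. w t * c t) mod m" for w :: "nat \<Rightarrow> nat"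
  proof -
    have "int (\<Sum>t<k. w t * b t) mod int m = int (\<Sum>t<k. w t * c t) mod int m"
      using that by (metis zmod_int)
    then have "int m dvd int (\<Sum>t<k. w t * b t) - int (\<Sum>t<k. w t * c t)"
      by (simp add: mod_eq_dvd_iff)
    then show ?thesis by (simp add: d_def right_diff_distrib sum_subtractf)
  qed
  have e0: "int m dvd d i + d j"
    using dvd[of "\<lambda>_. 1"] s0 supp[of "\<lambda>_. 1"] by simp
  have e1: "int m dvd int i * d i + int j * d j"
    using dvd[of "\<lambda>t. t"] s1 supp[of int] by simp
  \<comment> \<open>Coordinates lie below \<open>m\<close>, so their differences are smaller than
    \<open>m\<close> in absolute value.\<close>
  have small: "d t = 0" if "int m dvd d t" "t < k" for t
  proof (rule ccontr)
    assume "d t \<noteq> 0"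
    with that have "int m \<le> \<bar>d t\<bar>" by (metis abs_of_nat dvd_imp_le_int)
    then show False
      using hypercube_less[OF b that(2)] hypercube_less[OF c that(2)] by (simp add: d_def)
  qed
  \<comment> \<open>Subtracting \<open>i\<close> times the first check from the second eliminates
    \<open>d i\<close>.\<close>
  have "int m dvd (int i * d i + int j * d j) - int i * (d i + d j)"
    using e0 e1 by (intro dvd_diff dvd_mult)
  also have "(int i * d i + int j * d j) - int i * (d i + d j) = int (j - i) * d j"
    using ij by (simp add: of_nat_diff algebra_simps)
  finally have "int m dvd int (j - i) * d j" .
  moreover have "coprime (int m) (int (j - i))" using cop[of "j - i"] ij
    by (simp del: of_nat_diff)
  ultimately have "int m dvd d j" by (metis coprime_dvd_mult_right_iff)
  then have "d j = 0" using small ij by blast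
  with e0 have "d i = 0" using small[of i] ij by simp
  have "d t = 0" if "t < k" for t
    using that zero \<open>d i = 0\<close> \<open>d j = 0\<close> by blast
  then show ?thesis using b c by (intro hypercube_eqI[of b m k c]) (auto simp: d_def)
qed

text \<open>The pair of check sums distributes \<open>m ^ k\<close> words over \<open>m ^ 2\<close>
  values; a fibre of at least average size is the code.\<close>

lemma code3_exists:
  assumes k: "2 \<le> k" and m: "m > 0"
    and cop: "\<And>d. 0 < d \<Longrightarrow> d < k \<Longrightarrow> coprime m d"
  shows "\<exists>S. code3 m k S \<and> m ^ (k - 2) \<le> card S"
proof -
  define g where "g b = ((\<Sum>t<k. b t) mod m, (\<Sum>t<k. t * b t) mod m)" for b :: "nat \<Rightarrow> nat"
  have "m ^ k = m ^ 2 * m ^ (k - 2)" using k by (metis le_add_diff_inverse power_add)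
  then have "card (hypercube m k) = card ({..<m} \<times> {..<m}) * m ^ (k - 2)"
    by (simp add: card_hypercube power2_eq_square)
  moreover have "g ` hypercube m k \<subseteq> {..<m} \<times> {..<m}" "{..<m} \<times> {..<m} \<noteq> {}"
    using m by (auto simp: g_def)
  ultimately obtain y where y: "m ^ (k - 2) \<le> card {b \<in> hypercube m k. g b = y}"
    using fibre_pigeonhole[of "hypercube m k" "{..<m} \<times> {..<m}" g "m ^ (k - 2)"]
    by (meson finite_SigmaI finite_hypercube finite_lessThan)
  have "code3 m k {b \<in> hypercube m k. g b = y}"
    unfolding code3_def
  proof (intro conjI ballI allI impI)
    fix b c i j
    assume bc: "b \<in> {b \<in> hypercube m k. g b = y}" "c \<in> {b \<in> hypercube m k. g b = y}"
      and ij: "i < k" "j < k" and off: "agree_off k {i, j} b c"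
    \<comment> \<open>\<open>code3\<close> permits \<open>i = j\<close> and either order, whereas
      the check sums need an increasing pair. In the degenerate case a second coordinate is added,
      which exists because \<open>2 \<le> k\<close>.\<close>
    obtain i' j' where ij': "i' < j'" "j' < k" "{i, j} \<subseteq> {i', j'}"
    proof (cases i j rule: linorder_cases)
      case equal
      show ?thesis
      proof (cases "i = 0")
        case True
        then show ?thesis using that[of 0 1] equal k by auto
      next
        case False
        then show ?thesis using that[of 0 i] equal ij by auto
      qed
    qed (use that[of i j] that[of j i] ij in auto)
    then have "agree_off k {i', j'} b c" using off unfolding agree_off_def by blast
    moreover have "g b = g c" using bc by simp
    ultimately show "b = c"
      using weighted_sums_determine[OF _ _ cop _ _ ij'(1,2), of b c] bc by (simp add: g_def)
  qed auto
  then show ?thesis using y by blast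
qed

section \<open>Replacing each rook by a copy of a code\<close>

text \<open>The cube of side \<open>n * m\<close> is cut into cells of side \<open>m\<close>:
  \<open>P\<close> names the cell and \<open>b\<close> the position inside it.\<close>

definition refine :: "nat \<Rightarrow> nat \<Rightarrow> (nat \<Rightarrow> nat) \<Rightarrow> (nat \<Rightarrow> nat) \<Rightarrow> nat \<Rightarrow> nat" where
  "refine k m P b = (\<lambda>t\<in>{..<k}. P t * m + b t)"

lemma refine_div: "b \<in> hypercube m k \<Longrightarrow> t < k \<Longrightarrow> refine k m P b t div m = P t"
  using hypercube_less[of b m k t] by (simp add: refine_def)

lemma refine_in_hypercube:
  assumes "P \<in> hypercube n k" "b \<in> hypercube m k"
  shows "refine k m P b \<in> hypercube (n * m) k"
  unfolding refine_def
proof (rule restrict_in_hypercube)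
  fix t assume t: "t < k"
  have "P t * m + b t < (P t + 1) * m" using hypercube_less[OF assms(2) t] by simp
  also have "\<dots> \<le> n * m"
    using hypercube_less[OF assms(1) t] by (intro mult_right_mono) auto
  finally show "P t * m + b t < n * m" .
qed

text \<open>Passing from points to their cells turns an attack in the fine cube into an attack in
  the coarse cube.\<close>

lemma agree_off_refine_div:
  "agree_off k I Q (refine k m P b) \<Longrightarrow> b \<in> hypercube m k \<Longrightarrow>
    agree_off k I (\<lambda>t\<in>{..<k}. Q t div m) P"
  by (simp add: agree_off_def refine_div)

lemma agree_off_refine:
  assumes "agree_off k {i} Q (refine k m P b)" "agree_off k {i'} Q (refine k m P b')"
  shows "agree_off k {i, i'} b b'"
  using assms by (simp add: agree_off_def refine_def) (metis add_left_cancel)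

text \<open>The cell of \<open>Q\<close> is attacked by both coarse rooks, so these coincide. Within
  one cell the two code words then agree off \<open>{i, i'}\<close>, and minimum distance 3 makes
  them equal.\<close>

lemma refine_attack_unique:
  assumes R: "rook_packing n k l R" "l \<ge> 1" and S: "code3 m k S"
    and r: "(P, D) \<in> R" "(P', D') \<in> R" and b: "b \<in> S" "b' \<in> S"
    and Q: "Q \<in> hypercube (n * m) k" and i: "i \<in> D" "i' \<in> D'"
    and a: "agree_off k {i} Q (refine k m P b)" "agree_off k {i'} Q (refine k m P' b')"
  shows "((P, D), b) = ((P', D'), b')"
proof -
  have bm: "b \<in> hypercube m k" "b' \<in> hypercube m k" using S b by (auto simp: code3_def)
  have "(\<lambda>t\<in>{..<k}. Q t div m) \<in> hypercube n k"
    using hypercube_less[OF Q] by (intro restrict_in_hypercube) (simp add: less_mult_imp_div_less)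
  from rook_packingD[OF R r this i agree_off_refine_div[OF a(1) bm(1)]
      agree_off_refine_div[OF a(2) bm(2)]]
  have PD: "(P, D) = (P', D')" .
  have "i < k" "i' < k" using r i rook_packing_subset[OF R(1)] by (auto simp: rooks_def)
  moreover have "agree_off k {i, i'} b b'" using agree_off_refine[OF a(1)] a(2) PD by simp
  ultimately have "b = b'" using S b unfolding code3_def by blast
  with PD show ?thesis by simp
qed

lemma rook_packing_refine:
  assumes R: "rook_packing n k l R" and l: "l \<ge> 1" and S: "code3 m k S"
  defines "h \<equiv> \<lambda>x. (refine k m (fst (fst x)) (snd x), snd (fst x))"
  shows "rook_packing (n * m) k l (h ` (R \<times> S))"
  unfolding rook_packing_iff[OF l]
proof (intro conjI allI impI)
  have "fst x \<in> rooks n k l" "snd x \<in> hypercube m k" if "x \<in> R \<times> S" for x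
    using that rook_packing_subset[OF R] S unfolding code3_def by auto
  then have "h x \<in> rooks (n * m) k l" if "x \<in> R \<times> S" for x
    using that by (simp add: h_def rooks_def case_prod_unfold refine_in_hypercube)
  then show "h ` (R \<times> S) \<subseteq> rooks (n * m) k l" by blast
next
  fix X D X' D' Q i i'
  assume X: "(X, D) \<in> h ` (R \<times> S)" "(X', D') \<in> h ` (R \<times> S)"
    and Q: "Q \<in> hypercube (n * m) k" "i \<in> D" "i' \<in> D'"
      "agree_off k {i} Q X" "agree_off k {i'} Q X'"
  from X obtain P b P' b' where "(P, D) \<in> R" "b \<in> S" "(P', D') \<in> R" "b' \<in> S"
      "X = refine k m P b" "X' = refine k m P' b'"
    by (auto simp: h_def)
  then show "(X, D) = (X', D')"
    using refine_attack_unique[OF R l S, of P D P' D' b b' Q i i'] Q by simp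
qed

text \<open>Needed to count the refined packing as \<open>card R * card S\<close>. If two copies
  coincide, both attack their common point, and \<open>refine_attack_unique\<close> applies.\<close>

lemma inj_on_refine:
  assumes R: "rook_packing n k l R" and l: "l \<ge> 1" and S: "code3 m k S"
  shows "inj_on (\<lambda>x. (refine k m (fst (fst x)) (snd x), snd (fst x))) (R \<times> S)"
proof (rule inj_onI)
  fix x y assume xy: "x \<in> R \<times> S" "y \<in> R \<times> S"
    and eq: "(refine k m (fst (fst x)) (snd x), snd (fst x)) =
      (refine k m (fst (fst y)) (snd y), snd (fst y))"
  obtain P D b P' D' b' where x: "x = ((P, D), b)" and y: "y = ((P', D'), b')"
    by (metis surj_pair)
  have r: "(P, D) \<in> R" "(P', D') \<in> R" "b \<in> S" "b' \<in> S"
    and eq': "D = D'" "refine k m P b = refine k m P' b'"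
    using xy eq by (simp_all add: x y)
  have "D \<noteq> {}" using r(1) l rook_packing_subset[OF R] by (auto simp: rooks_def)
  then obtain i where i: "i \<in> D" by blast
  have "b \<in> hypercube m k" using S r(3) by (auto simp: code3_def)
  then have Q: "refine k m P b \<in> hypercube (n * m) k"
    by (rule refine_in_hypercube[OF rook_packing_in_hypercube[OF R r(1)]])
  have "agree_off k {i} (refine k m P b) (refine k m P b)" by (simp add: agree_off_def)
  with refine_attack_unique[OF R l S r Q i, of i] show "x = y"
    using i eq' unfolding x y by simp
qed

lemma max_rooks_blow_up:
  assumes k: "2 \<le> k" and m: "m > 0" and l: "l \<ge> 1"
    and cop: "\<And>d. 0 < d \<Longrightarrow> d < k \<Longrightarrow> coprime m d"
  shows "m ^ (k - 2) * max_rooks n k l \<le> max_rooks (n * m) k l"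
proof -
  obtain S where S: "code3 m k S" "m ^ (k - 2) \<le> card S"
    using code3_exists[OF k m cop] by blast
  obtain R where R: "rook_packing n k l R" and card: "card R = max_rooks n k l"
    by (rule max_rooks_attained)
  have "card R * card S \<le> max_rooks (n * m) k l"
    using card_le_max_rooks[OF rook_packing_refine[OF R l S(1)]]
    by (simp add: card_image[OF inj_on_refine[OF R l S(1)]] card_cartesian_product)
  moreover have "m ^ (k - 2) * card R \<le> card R * card S"
    using S(2) by simp
  ultimately show ?thesis using card by (metis le_trans)
qed

section \<open>Convergence of the density\<close>

text \<open>The limit is the supremum over positive indices: for a fixed \<open>n\<close> with
  \<open>f n\<close> above a given \<open>a < L\<close>, the correction factor tends to 1 as
  \<open>N\<close> grows, so \<open>f N\<close> eventually exceeds \<open>a\<close>.\<close>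

lemma convergent_of_almost_increasing:
  fixes f C :: "nat \<Rightarrow> real"
  assumes bdd: "\<And>n. f n \<le> B"
    and inc: "\<And>n N. 0 < n \<Longrightarrow> real N \<ge> C n \<Longrightarrow> N \<ge> n \<Longrightarrow> f n * (1 - C n / real N) ^ d \<le> f N"
  shows "convergent f"
proof -
  define L where "L = (SUP n\<in>{0<..}. f n)"
  have bd: "bdd_above (f ` {0<..})" using bdd by (intro bdd_aboveI[of _ B]) auto
  have "f \<longlonglongrightarrow> L"
  proof (rule order_tendstoI)
    fix a assume "a < L"
    then obtain n where n: "n > 0" "a < f n"
      unfolding L_def using less_cSUP_iff[OF _ bd, of a] by auto
    have "(\<lambda>N. f n * (1 - C n / real N) ^ d) \<longlonglongrightarrow> f n * (1 - 0) ^ d"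
      by (intro tendsto_intros lim_const_over_n)
    then have "eventually (\<lambda>N. a < f n * (1 - C n / real N) ^ d) sequentially"
      using n by (intro order_tendstoD(1)) auto
    moreover have "eventually (\<lambda>N. N \<ge> n \<and> real N \<ge> C n) sequentially"
      by (intro eventually_conj eventually_ge_at_top
          filterlim_real_sequentially[THEN filterlim_at_top[THEN iffD1], rule_format])
    ultimately show "eventually (\<lambda>N. a < f N) sequentially"
      by eventually_elim (use inc[OF n(1)] in force)
  next
    fix a assume "L < a"
    have "f N \<le> L" if "N > 0" for N
      unfolding L_def using that bd by (intro cSUP_upper) auto
    with \<open>L < a\<close> show "eventually (\<lambda>N. f N < a) sequentially"
      by (intro eventually_mono[OF eventually_gt_at_top[of 0]]) (rule le_less_trans)
  qed
  then show ?thesis by (rule convergentI)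
qed

text \<open>\<open>N\<close> is approximated from below by an admissible multiple
  \<open>n * m\<close>; the factor with \<open>n * fact k\<close> pays for the rounding.\<close>

lemma max_rooks_density_almost_increasing:
  assumes l: "2 \<le> l" and k: "2 \<le> k" and n: "0 < n" and N: "n \<le> N" "n * fact k \<le> N"
  shows "real (max_rooks n k l) / real n ^ (k - 2) * (1 - real (n * fact k) / real N) ^ (k - 2)
    \<le> real (max_rooks N k l) / real N ^ (k - 2)"
proof -
  \<comment> \<open>Since \<open>n * m = n + t * c\<close>, the usable multiples of \<open>n\<close>
    are \<open>c\<close> apart, and this \<open>t\<close> gives the largest one not exceeding
    \<open>N\<close>.\<close>
  define c t m where "c = n * fact k" and "t = (N - n) div c" and "m = 1 + t * fact k"
  have "c > 0" using n by (simp add: c_def)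
  have nm: "n * m = n + t * c" by (simp add: m_def c_def algebra_simps)
  have "t * c \<le> N - n" unfolding t_def by (rule div_times_less_eq_dividend)
  then have upper: "n * m \<le> N" using N nm by simp
  have "N - n < t * c + c"
    unfolding t_def using dividend_less_div_times[OF \<open>c > 0\<close>, of "N - n"] by (simp add: add.commute)
  then have lower: "N - c \<le> n * m" using nm N by simp
  \<comment> \<open>Each such \<open>d\<close> divides \<open>fact k\<close>, and \<open>m\<close>
    is 1 modulo \<open>fact k\<close>.\<close>
  have cop: "coprime m d" if "0 < d" "d < k" for d
  proof -
    have "d dvd fact k" using that by (intro dvd_fact) auto
    then have "d dvd t * fact k" by simp
    moreover have "coprime (t * fact k + 1) (t * fact k)" by (simp only: coprime_add_one_left)
    ultimately show ?thesis unfolding m_def by (metis add.commute coprime_divisors dvd_refl)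
  qed
  have "m ^ (k - 2) * max_rooks n k l \<le> max_rooks (n * m) k l"
    using l by (intro max_rooks_blow_up[OF k _ _ cop]) (auto simp: m_def)
  also have "\<dots> \<le> max_rooks N k l" using l upper by (intro max_rooks_mono) auto
  finally have main: "real m ^ (k - 2) * real (max_rooks n k l) \<le> real (max_rooks N k l)"
    by (metis of_nat_le_iff of_nat_mult of_nat_power)
  have N0: "real N > 0" using n N by simp
  \<comment> \<open>The truncated difference \<open>N - c\<close> is exact because
    \<open>n * fact k \<le> N\<close>; this also makes the base nonnegative, as
    \<open>power_mono\<close> requires.\<close>
  have eq: "1 - real c / real N = real (N - c) / real N"
    using N(2) N0 unfolding c_def by (subst of_nat_diff) (simp_all add: diff_divide_distrib)
  also have "\<dots> \<le> real (n * m) / real N" using lower by (intro divide_right_mono) linarith+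
  finally have "(1 - real c / real N) ^ (k - 2) \<le> (real (n * m) / real N) ^ (k - 2)"
    by (rule power_mono) (simp add: eq)
  then have "real (max_rooks n k l) / real n ^ (k - 2) * (1 - real c / real N) ^ (k - 2)
      \<le> real (max_rooks n k l) / real n ^ (k - 2) * (real (n * m) / real N) ^ (k - 2)"
    by (intro mult_left_mono) auto
  also have "\<dots> = real m ^ (k - 2) * real (max_rooks n k l) / real N ^ (k - 2)"
    using n by (simp add: power_divide power_mult_distrib)
  also have "\<dots> \<le> real (max_rooks N k l) / real N ^ (k - 2)"
    using main by (intro divide_right_mono) auto
  finally show ?thesis by (simp add: c_def)
qed

theorem theorem6:
  fixes k l :: nat
  assumes "2 \<le> l" and "l \<le> k"
  shows "convergent (\<lambda>n. real (max_rooks n k l) / real n ^ (k - 2))"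
proof (rule convergent_of_almost_increasing)
  fix n
  have "real (max_rooks n k l) \<le> real (k * k) * real n ^ (k - 2)"
    using max_rooks_le[OF assms(1), of n k] by (metis of_nat_le_iff of_nat_mult of_nat_power)
  then show "real (max_rooks n k l) / real n ^ (k - 2) \<le> real (k * k)"
    \<comment> \<open>For \<open>n = 0\<close> and \<open>k > 2\<close> the denominator is 0, and
      the quotient is 0 by convention.\<close>
    by (cases "real n ^ (k - 2) = 0") (simp_all add: divide_le_eq)
next
  fix n N :: nat
  assume n: "0 < n" and N: "real (n * fact k) \<le> real N" "n \<le> N"
  show "real (max_rooks n k l) / real n ^ (k - 2) * (1 - real (n * fact k) / real N) ^ (k - 2)
      \<le> real (max_rooks N k l) / real N ^ (k - 2)"
    using N assms by (intro max_rooks_density_almost_increasing n) (auto simp only: of_nat_le_iff)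
qed

end
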